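(* Let $X$ be a finite set, $\alpha:X\to X$ a bijection and $E\subseteq X$ with $(X,\alpha)$ $E$-bound. Let $\widehat X=X\times\{-1,1\}$, $\widehat E=E\times\{1\}\sqcup E\times\{-1\}$, $\widehat\alpha(i,s)=(\alpha^s i,s)$, $r(i,s)=(i,-s)$; then $(\widehat X,\widehat\alpha,r)$ is reversible and $\widehat E$-bound, and we consider the system $(\widehat X,[0,\widehat L],\widehat e,\widehat\alpha,r)$. Then: (a) $\widehat E$ is $r$-invariant; $\widehat E$ is $s$-stable (for $\widehat\alpha$) if and only if $E$ is $s$-stable (for $\alpha$); $\widehat L=\max_{i\in X}e(i)=\max_{i\in X}e_{-1}(i)=L$; and $\widehat X_k=(X_k\times\{1\})\sqcup(X_{-k}\times\{-1\})$ with $|\widehat X_k|=2|X_k|$. (b) If $(i_{k+1},s)\to(i_k,s)\to\cdots\to(i_0,s)$ is an $\widehat\alpha$-path (i.e. $\widehat\alpha(i_{u+1},s)=(i_u,s)$) with $(i_0,s),(i_{k+1},s)\in\widehat E$ and $(i_u,s)\in\widehat X\setminus\widehat E$ for $u\in[1,k]$, then for $u\in[1,k]$: $S(r(i_u,s))=S(i_u,s)$ if and only if $|X_u|=|X_{k-u+1}|$. (c) $e(\alpha(E))=[0,L]$ if and only if $\widehat e(\widehat\alpha(\widehat E))=[0,L]$. (d) Assume $e(\alpha(E))=[0,L]$. Then $\widehat X^{\mathrm{eq}}=\widehat E$, $\widehat X^{\mathrm{neq}}=\widehat X\setminus\widehat E$, $\widehat D=\{x\in\widehat X^{\mathrm{eq}}:\widehat\alpha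 x\in\widehat X^{\mathrm{neq}}\}$, entropy is strictly increasing on $\widehat X^{\mathrm{neq}}$, and $|[\![\widehat X^{\mathrm{eq}},\widehat X_k]\!]|=2(|X_k|-|X_{k+1}|)$ for $k\in[0,L]$. For paths as in (b), $S(r(i_u,s))=S(i_u,s)$ if and only if $u=\frac{k+1}{2}$. Furthermore $\frac{|\widehat D|}{|\widehat X|}=\frac{|D|}{|X|}$, $\frac{|\widehat I|}{|\widehat X|}=\frac{|I|}{|X|}$, $\frac{|\widehat C|}{|\widehat X|}=\frac{|C|}{|X|}$, and $\langle\widehat{\mathcal A}\rangle=\langle\mathcal A\rangle$.
   Context: $(X,\alpha)$ is $E$-bound if every $\alpha$-cycle meets $E$. The $E$-reaching time is $e(i)=$ the smallest $k\ge0$ with $\alpha^k(i)\in E$, $L=\max e$, $X_k=e^{-1}(k)$, $X_{L+1}=\emptyset$; $e_{-1}(i)$ is the smallest $k\ge0$ with $\alpha^{-k}(i)\in E$ and $X_{-k}=e_{-1}^{-1}(k)$. Analogously $\widehat e(x)$ is the smallest $k\ge0$ with $\widehat\alpha^k(x)\in\widehat E$, $\widehat L=\max\widehat e$, $\widehat X_k=\widehat e^{-1}(k)$. For a system with bijection $\beta$ on microstates $Y$ and reaching-time map $f$ (macrostates $[0,\max f]$), entropy is $S(y)=\ln|f^{-1}(f(y))|$; $Y^{\mathrm{eq}}$ is the set of microstates in macrostates of maximal size, $Y^{\mathrm{neq}}$ its complement; $D,C,I$ (resp. $\widehat D,\widehat C,\widehat I$) are the sets where $S(\beta y)<S(y)$,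 $=$, $>$ for $(X,[0,L],e,\alpha)$ (resp. $(\widehat X,[0,L],\widehat e,\widehat\alpha)$). $[\![U,V]\!]=\{y\in U:\beta(y)\in V\}$. A set $F$ is $s$-stable for $\beta$ if for every $y\in F\cap\beta(Y\setminus F)$, $\beta^k y\in F$ for $0\le k\le s$. $\mathcal A(y)$ is the largest $N\ge0$ with $S(y)<S(\beta y)<\cdots<S(\beta^N y)$, and $\langle\mathcal A\rangle$, $\langle\widehat{\mathcal A}\rangle$ are its means under the uniform distribution on $X$, resp. $\widehat X$. *)

theory Defs
  imports Complex_Main "HOL-Combinatorics.Orbits"
begin

text \<open>
  A microstate space is a finite carrier set \<open>Y\<close> with a map \<open>\<beta>\<close> that is only meaningful on \<open>Y\<close>;
  its inverse is \<open>inv_into Y \<beta>\<close>. A coarse graining is given by a reaching-time map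
  \<open>f :: 'a \<Rightarrow> nat\<close>, with macrostates \<open>{0..Max (f ` Y)}\<close>.
\<close>

definition int_iter :: "'a set \<Rightarrow> ('a \<Rightarrow> 'a) \<Rightarrow> int \<Rightarrow> 'a \<Rightarrow> 'a" where
  "int_iter Y \<beta> n =
     (if n \<ge> 0 then \<beta> ^^ nat n else inv_into Y \<beta> ^^ nat (- n))"

definition bound_by :: "'a set \<Rightarrow> ('a \<Rightarrow> 'a) \<Rightarrow> 'a set \<Rightarrow> bool" where
  "bound_by Y \<beta> F \<longleftrightarrow> (\<forall>C. C \<subseteq> Y \<and> cyclic_on \<beta> C \<longrightarrow> C \<inter> F \<noteq> {})"

definition reversible :: "'a set \<Rightarrow> ('a \<Rightarrow> 'a) \<Rightarrow> ('a \<Rightarrow> 'a) \<Rightarrow> bool" where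
  "reversible Y \<beta> r \<longleftrightarrow>
     bij_betw \<beta> Y Y \<and> r ` Y \<subseteq> Y \<and> (\<forall>y\<in>Y. r (r y) = y) \<and>
     (\<forall>y\<in>Y. r (\<beta> (r y)) = inv_into Y \<beta> y)"

definition reach_time :: "('a \<Rightarrow> 'a) \<Rightarrow> 'a set \<Rightarrow> 'a \<Rightarrow> nat" where
  "reach_time \<beta> F y = (LEAST k. (\<beta> ^^ k) y \<in> F)"

definition level :: "'a set \<Rightarrow> ('a \<Rightarrow> nat) \<Rightarrow> nat \<Rightarrow> 'a set" where
  "level Y f k = {y \<in> Y. f y = k}"

definition entropy :: "'a set \<Rightarrow> ('a \<Rightarrow> nat) \<Rightarrow> 'a \<Rightarrow> real" where
  "entropy Y f y = ln (real (card (level Y f (f y))))"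

definition eq_states :: "'a set \<Rightarrow> ('a \<Rightarrow> nat) \<Rightarrow> 'a set" where
  "eq_states Y f =
     {y \<in> Y. card (level Y f (f y)) = Max ((\<lambda>m. card (level Y f m)) ` {0..Max (f ` Y)})}"

definition neq_states :: "'a set \<Rightarrow> ('a \<Rightarrow> nat) \<Rightarrow> 'a set" where
  "neq_states Y f = Y - eq_states Y f"

definition entropy_dec :: "'a set \<Rightarrow> ('a \<Rightarrow> nat) \<Rightarrow> ('a \<Rightarrow> 'a) \<Rightarrow> 'a set" where
  "entropy_dec Y f \<beta> = {y \<in> Y. entropy Y f (\<beta> y) < entropy Y f y}"

definition entropy_const :: "'a set \<Rightarrow> ('a \<Rightarrow> nat) \<Rightarrow> ('a \<Rightarrow> 'a) \<Rightarrow> 'a set" where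
  "entropy_const Y f \<beta> = {y \<in> Y. entropy Y f (\<beta> y) = entropy Y f y}"

definition entropy_inc :: "'a set \<Rightarrow> ('a \<Rightarrow> nat) \<Rightarrow> ('a \<Rightarrow> 'a) \<Rightarrow> 'a set" where
  "entropy_inc Y f \<beta> = {y \<in> Y. entropy Y f (\<beta> y) > entropy Y f y}"

definition transitions :: "('a \<Rightarrow> 'a) \<Rightarrow> 'a set \<Rightarrow> 'a set \<Rightarrow> 'a set" where
  "transitions \<beta> U V = {y \<in> U. \<beta> y \<in> V}"

definition s_stable :: "'a set \<Rightarrow> ('a \<Rightarrow> 'a) \<Rightarrow> nat \<Rightarrow> 'a set \<Rightarrow> bool" where
  "s_stable Y \<beta> s F \<longleftrightarrow> (\<forall>y \<in> F \<inter> \<beta> ` (Y - F). \<forall>k \<le> s. (\<beta> ^^ k) y \<in> F)"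

definition incr_length :: "'a set \<Rightarrow> ('a \<Rightarrow> nat) \<Rightarrow> ('a \<Rightarrow> 'a) \<Rightarrow> 'a \<Rightarrow> nat" where
  "incr_length Y f \<beta> y =
     (GREATEST N. \<forall>j < N. entropy Y f ((\<beta> ^^ j) y) < entropy Y f ((\<beta> ^^ Suc j) y))"

definition mean_incr_length :: "'a set \<Rightarrow> ('a \<Rightarrow> nat) \<Rightarrow> ('a \<Rightarrow> 'a) \<Rightarrow> real" where
  "mean_incr_length Y f \<beta> = (\<Sum>y\<in>Y. real (incr_length Y f \<beta> y)) / real (card Y)"

definition hat_space :: "'a set \<Rightarrow> ('a \<times> int) set" where
  "hat_space X = X \<times> {-1, 1}"

definition hat_target :: "'a set \<Rightarrow> ('a \<times> int) set" where
  "hat_target E = E \<times> {1} \<union> E \<times> {-1}"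

definition hat_map :: "'a set \<Rightarrow> ('a \<Rightarrow> 'a) \<Rightarrow> 'a \<times> int \<Rightarrow> 'a \<times> int" where
  "hat_map X \<alpha> = (\<lambda>(i, s). (int_iter X \<alpha> s i, s))"

definition hat_rev :: "'a \<times> int \<Rightarrow> 'a \<times> int" where
  "hat_rev = (\<lambda>(i, s). (i, - s))"

text \<open>
  The path \<open>(i (k+1), s) \<rightarrow> \<dots> \<rightarrow> (i 0, s)\<close>, indexed by the number of steps that remain to its end,
  leaves \<open>F\<close> and returns to \<open>F\<close> with exactly \<open>k\<close> intermediate points outside \<open>F\<close>.
\<close>

definition excursion ::
    "('a \<times> int) set \<Rightarrow> ('a \<times> int \<Rightarrow> 'a \<times> int) \<Rightarrow> ('a \<times> int) set \<Rightarrow> (nat \<Rightarrow> 'a) \<Rightarrow> int \<Rightarrow> nat \<Rightarrow> bool" where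
  "excursion Y \<beta> F i s k \<longleftrightarrow>
     (\<forall>u \<le> k. \<beta> (i (Suc u), s) = (i u, s)) \<and>
     (i 0, s) \<in> F \<and> (i (Suc k), s) \<in> F \<and>
     (\<forall>u \<in> {1..k}. (i u, s) \<in> Y - F)"

end

theory Submission
  imports Defs
begin

text \<open>
  A point has forward reaching time at least \<open>k\<close> iff it starts a run of \<open>k\<close> points outside \<open>F\<close>,
  and backward reaching time at least \<open>k\<close> iff it ends one; \<open>\<beta> ^^ (k - 1)\<close> is a bijection from
  the former points onto the latter. Hence forward and backward levels have equal size, and
  the levels of the doubled system are twice as large as those of the original one. Moreover
  \<open>\<beta>\<close> embeds level \<open>k + 1\<close> into level \<open>k\<close>, and what is missed are exactly the entries from \<open>F\<close>;
  so all conditions and quantities in (c) and (d) are functions of the level sizes alone.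
\<close>

section \<open>Iterates and orbits of a bijection on a finite set\<close>

lemma funpow_mem:
  assumes "bij_betw \<beta> Y Y" "y \<in> Y"
  shows "(\<beta> ^^ k) y \<in> Y"
  using assms by (induction k) (auto simp: bij_betw_def)

lemma funpow_inv_into_funpow:
  assumes bij: "bij_betw \<beta> Y Y" and y: "y \<in> Y" and "j \<le> m"
  shows "(inv_into Y \<beta> ^^ j) ((\<beta> ^^ m) y) = (\<beta> ^^ (m - j)) y"
  using \<open>j \<le> m\<close>
proof (induction j)
  case (Suc j)
  then obtain d where d: "m - j = Suc d" "m - Suc j = d"
    by (metis Suc_diff_Suc Suc_le_lessD)
  have "(\<beta> ^^ d) y \<in> Y" by (rule funpow_mem[OF bij y])
  then show ?case using Suc d bij by (simp add: bij_betw_inv_into_left)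
qed simp

lemma funpow_funpow_inv_into:
  assumes bij: "bij_betw \<beta> Y Y" and y: "y \<in> Y" and "j \<le> m"
  shows "(\<beta> ^^ j) ((inv_into Y \<beta> ^^ m) y) = (inv_into Y \<beta> ^^ (m - j)) y"
  using \<open>j \<le> m\<close>
proof (induction j)
  case (Suc j)
  then obtain d where d: "m - j = Suc d" "m - Suc j = d"
    by (metis Suc_diff_Suc Suc_le_lessD)
  have "(inv_into Y \<beta> ^^ d) y \<in> Y"
    by (rule funpow_mem[OF bij_betw_inv_into[OF bij] y])
  then show ?case using Suc d bij by (simp add: bij_betw_inv_into_right)
qed simp

lemma funpow_returns:
  assumes fin: "finite Y" and bij: "bij_betw \<beta> Y Y" and y: "y \<in> Y"
  obtains n where "n > 0" "(\<beta> ^^ n) y = y"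
proof -
  have "range (\<lambda>n. (\<beta> ^^ n) y) \<subseteq> Y" using funpow_mem[OF bij y] by auto
  then have "\<not> inj (\<lambda>n. (\<beta> ^^ n) y)"
    using fin by (meson finite_imageD finite_subset infinite_UNIV_nat)
  then obtain a b where ab: "a < b" "(\<beta> ^^ a) y = (\<beta> ^^ b) y"
    unfolding inj_def by (metis linorder_neqE_nat)
  \<comment> \<open>Undoing \<open>a\<close> steps on both sides of the coincidence found by
    pigeonhole.\<close>
  have "y = (\<beta> ^^ (b - a)) y"
    using funpow_inv_into_funpow[OF bij y, of a a] funpow_inv_into_funpow[OF bij y, of a b] ab
    by simp
  then show ?thesis using that[of "b - a"] ab by simp
qed

text \<open>Cycles are orbits, and \<open>orbit\<close> starts at the first iterate. A point
  therefore lies on its own orbit only because it returns after a positive number of steps; this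
  makes its orbit a cycle, which must meet \<open>F\<close>.\<close>

lemma bound_by_iff_reaches:
  assumes fin: "finite Y" and bij: "bij_betw \<beta> Y Y"
  shows "bound_by Y \<beta> F \<longleftrightarrow> (\<forall>y\<in>Y. \<exists>k. (\<beta> ^^ k) y \<in> F)"
proof (intro iffI ballI)
  fix y assume b: "bound_by Y \<beta> F" and y: "y \<in> Y"
  obtain n where "n > 0" "(\<beta> ^^ n) y = y" using funpow_returns[OF fin bij y] .
  then have "y \<in> orbit \<beta> y" unfolding orbit_altdef by force
  moreover have "orbit \<beta> y \<subseteq> Y" using funpow_mem[OF bij y] by (auto simp: orbit_altdef)
  ultimately have "orbit \<beta> y \<inter> F \<noteq> {}"
    using b unfolding bound_by_def cyclic_on_def by blast
  then show "\<exists>k. (\<beta> ^^ k) y \<in> F" by (auto simp: orbit_altdef)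
next
  assume r: "\<forall>y\<in>Y. \<exists>k. (\<beta> ^^ k) y \<in> F"
  show "bound_by Y \<beta> F"
    unfolding bound_by_def cyclic_on_def
  proof (intro allI impI, elim conjE bexE)
    fix C s assume C: "C \<subseteq> Y" "s \<in> C" "C = orbit \<beta> s"
    then obtain k where k: "(\<beta> ^^ k) s \<in> F" using r by blast
    have "(\<beta> ^^ k) s \<in> C"
      using C by (induction k) (auto intro: orbit.step)
    then show "C \<inter> F \<noteq> {}" using k by blast
  qed
qed

section \<open>Counting by levels, comparing entropies, reversing time\<close>

lemma card_level_plus_card_ge:
  assumes "finite Y"
  shows "card (level Y f k) + card {y \<in> Y. Suc k \<le> f y} = card {y \<in> Y. k \<le> f y}"
proof -
  have "{y \<in> Y. k \<le> f y} = level Y f k \<union> {y \<in> Y. Suc k \<le> f y}"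
    by (auto simp: level_def)
  moreover have "level Y f k \<inter> {y \<in> Y. Suc k \<le> f y} = {}" by (auto simp: level_def)
  ultimately show ?thesis using assms by (simp add: card_Un_disjoint level_def)
qed

lemma image_eq_nonempty_levels: "f ` Y = {k. level Y f k \<noteq> {}}"
  by (auto simp: level_def)

lemma sum_by_levels:
  assumes "finite Y"
  shows "(\<Sum>y\<in>Y. real (f y)) = (\<Sum>k\<in>f ` Y. real k * real (card (level Y f k)))"
proof -
  have "(\<Sum>y\<in>Y. real (f y)) = (\<Sum>k\<in>f ` Y. \<Sum>y\<in>{y \<in> Y. f y = k}. real (f y))"
    by (rule sum.group[symmetric]) (use assms in auto)
  also have "\<dots> = (\<Sum>k\<in>f ` Y. real k * real (card (level Y f k)))"
    by (rule sum.cong) (auto simp: level_def)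
  finally show ?thesis .
qed

text \<open>Each point lies in its own level, so both sizes are positive, where \<open>ln\<close> is
  strictly increasing.\<close>

lemma entropy_less_iff:
  assumes "finite Y" "y \<in> Y" "z \<in> Y"
  shows "entropy Y f y < entropy Y f z \<longleftrightarrow> card (level Y f (f y)) < card (level Y f (f z))"
proof -
  have "card (level Y f (f y)) > 0" "card (level Y f (f z)) > 0"
    using assms by (auto simp: level_def card_gt_0_iff)
  then show ?thesis by (simp add: entropy_def)
qed

lemma entropy_eq_iff:
  assumes "finite Y" "y \<in> Y" "z \<in> Y"
  shows "entropy Y f y = entropy Y f z \<longleftrightarrow> card (level Y f (f y)) = card (level Y f (f z))"
proof -
  have "card (level Y f (f y)) > 0" "card (level Y f (f z)) > 0"
    using assms by (auto simp: level_def card_gt_0_iff)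
  then show ?thesis by (simp add: entropy_def)
qed

text \<open>Reversibility makes \<open>r\<close> conjugate \<beta> to its inverse on
  \<open>Y\<close>, and \<open>r\<close> preserves \<open>F\<close>; so the \<beta>-orbit of
  \<open>r y\<close> meets \<open>F\<close> exactly when the backward orbit of \<open>y\<close>
  does.\<close>

lemma reach_time_reversed:
  assumes rev: "reversible Y \<beta> r" and F: "F \<subseteq> Y" "r ` F = F" and y: "y \<in> Y"
  shows "reach_time \<beta> F (r y) = reach_time (inv_into Y \<beta>) F y"
proof -
  have bij: "bij_betw \<beta> Y Y" and rY: "\<And>z. z \<in> Y \<Longrightarrow> r z \<in> Y"
    and rr: "\<And>z. z \<in> Y \<Longrightarrow> r (r z) = z"
    and conj: "\<And>z. z \<in> Y \<Longrightarrow> r (\<beta> (r z)) = inv_into Y \<beta> z"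
    using rev by (auto simp: reversible_def)
  have inY: "(inv_into Y \<beta> ^^ k) y \<in> Y" for k
    by (rule funpow_mem[OF bij_betw_inv_into[OF bij] y])
  have step: "\<beta> (r z) = r (inv_into Y \<beta> z)" if "z \<in> Y" for z
    using conj[OF that] rr[of "\<beta> (r z)"] rY[OF that] bij by (metis bij_betwE)
  have "(\<beta> ^^ k) (r y) = r ((inv_into Y \<beta> ^^ k) y)" for k
    by (induction k) (auto simp: step inY)
  moreover have "r z \<in> F \<longleftrightarrow> z \<in> F" if "z \<in> Y" for z
    using F rr that by (metis image_eqI)
  ultimately show ?thesis by (simp add: reach_time_def inY)
qed

section \<open>Reaching times in a bound system\<close>

locale bound_system =
  fixes Y :: "'b set" and \<beta> :: "'b \<Rightarrow> 'b" and F :: "'b set"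
  assumes finite_Y: "finite Y" and bij: "bij_betw \<beta> Y Y" and F_sub: "F \<subseteq> Y"
    and reaches: "\<And>y. y \<in> Y \<Longrightarrow> \<exists>k. (\<beta> ^^ k) y \<in> F"
begin

abbreviation f where "f \<equiv> reach_time \<beta> F"
abbreviation \<gamma> where "\<gamma> \<equiv> inv_into Y \<beta>"
abbreviation g where "g \<equiv> reach_time \<gamma> F"
abbreviation lv where "lv \<equiv> level Y f"
abbreviation L where "L \<equiv> Max (f ` Y)"

lemma \<beta>_mem: "y \<in> Y \<Longrightarrow> \<beta> y \<in> Y"
  using bij by (rule bij_betw_apply)

text \<open>If \<open>y\<close> has period \<open>n\<close>, then \<open>y\<close> is also its own
  iterate of order \<open>n * k\<close>, and going back \<open>n * k - k\<close> steps from there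
  lands on the forward iterate of order \<open>k\<close>, which is in \<open>F\<close>. As an
  instance of the locale, the inverse inherits every result about \<open>f\<close> for
  \<open>g\<close>.\<close>

lemma inverse_system: "bound_system Y \<gamma> F"
proof
  fix y assume y: "y \<in> Y"
  obtain k where k: "(\<beta> ^^ k) y \<in> F" using reaches[OF y] by blast
  obtain n where n: "n > 0" "(\<beta> ^^ n) y = y" using funpow_returns[OF finite_Y bij y] .
  have "(\<beta> ^^ (n * k)) y = y"
    by (induction k) (use n in \<open>auto simp: funpow_add\<close>)
  moreover have "k \<le> n * k" using n by simp
  ultimately have "(\<gamma> ^^ (n * k - k)) y = (\<beta> ^^ k) y"
    using funpow_inv_into_funpow[OF bij y, of "n * k - k" "n * k"] by simp
  then show "\<exists>k. (\<gamma> ^^ k) y \<in> F" using k by metis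
qed (use finite_Y bij F_sub bij_betw_inv_into in auto)

lemma reach_time_0_iff: "y \<in> Y \<Longrightarrow> f y = 0 \<longleftrightarrow> y \<in> F"
proof
  assume y: "y \<in> Y" "f y = 0"
  \<comment> \<open>A \<open>LEAST\<close> over no hits would be unspecified; reachability ensures
    that it is attained.\<close>
  obtain k where "(\<beta> ^^ k) y \<in> F" using reaches y by blast
  then have "(\<beta> ^^ f y) y \<in> F" unfolding reach_time_def by (rule LeastI)
  then show "y \<in> F" using y by simp
qed (simp add: reach_time_def)

lemma reach_time_step:
  assumes "y \<in> Y" "y \<notin> F"
  shows "f y = Suc (f (\<beta> y))"
proof -
  obtain k where "(\<beta> ^^ k) y \<in> F" using reaches assms by blast
  then have "f y = Suc (LEAST k. (\<beta> ^^ Suc k) y \<in> F)"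
    unfolding reach_time_def by (rule Least_Suc) (use assms in simp)
  then show ?thesis by (simp add: reach_time_def funpow_swap1)
qed

lemma Suc_le_reach_time_iff:
  assumes "y \<in> Y"
  shows "Suc m \<le> f y \<longleftrightarrow> (\<forall>j\<le>m. (\<beta> ^^ j) y \<notin> F)"
proof -
  obtain k where "(\<beta> ^^ k) y \<in> F" using reaches assms by blast
  then have "(\<beta> ^^ f y) y \<in> F" unfolding reach_time_def by (rule LeastI)
  moreover have "(\<beta> ^^ j) y \<notin> F" if "j < f y" for j
    using that not_less_Least unfolding reach_time_def by blast
  ultimately show ?thesis by (meson le_less_trans not_less_eq_eq not_le)
qed

lemma finite_level: "finite (lv k)"
  using finite_Y by (simp add: level_def)

lemma level_0: "lv 0 = F"
  using reach_time_0_iff F_sub by (auto simp: level_def)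

lemma reach_time_le_L: "y \<in> Y \<Longrightarrow> f y \<le> L"
  using finite_Y by simp

section \<open>Level sizes, forwards and backwards\<close>

lemma card_transitions: "card (transitions \<beta> F (lv k)) + card (lv (Suc k)) = card (lv k)"
proof -
  let ?T = "transitions \<beta> F (lv k)"
  have inj: "inj_on \<beta> Y" using bij by (rule bij_betw_imp_inj_on)
  have T: "?T \<subseteq> Y" and l: "lv (Suc k) \<subseteq> Y"
    using F_sub by (auto simp: transitions_def level_def)
  \<comment> \<open>Points of \<open>?T\<close> lie in \<open>F\<close> and have reaching time
    0.\<close>
  have disj: "?T \<inter> lv (Suc k) = {}"
  proof -
    have "f x = 0" if "x \<in> ?T" for x
      using that F_sub reach_time_0_iff[of x] by (auto simp: transitions_def)
    then show ?thesis by (fastforce simp: level_def)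
  qed
  \<comment> \<open>A preimage of a point of level \<open>k\<close> is either in \<open>F\<close>,
    hence in \<open>?T\<close>, or outside \<open>F\<close> and then has reaching time one
    larger.\<close>
  have "\<beta> ` (?T \<union> lv (Suc k)) = lv k"
  proof
    show "\<beta> ` (?T \<union> lv (Suc k)) \<subseteq> lv k"
    proof
      fix z assume "z \<in> \<beta> ` (?T \<union> lv (Suc k))"
      then obtain y where y: "z = \<beta> y" "y \<in> ?T \<or> y \<in> Y \<and> f y = Suc k"
        by (auto simp: level_def)
      then show "z \<in> lv k"
        using reach_time_step[of y] reach_time_0_iff[of y] \<beta>_mem[of y]
        by (cases "y \<in> F") (auto simp: transitions_def level_def)
    qed
    show "lv k \<subseteq> \<beta> ` (?T \<union> lv (Suc k))"
    proof
      fix z assume z: "z \<in> lv k"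
      then obtain y where y: "y \<in> Y" "z = \<beta> y"
        using bij by (auto simp: level_def bij_betw_def)
      then have "y \<in> ?T \<union> lv (Suc k)"
        using z reach_time_step[of y] by (auto simp: transitions_def level_def)
      then show "z \<in> \<beta> ` (?T \<union> lv (Suc k))" using y by blast
    qed
  qed
  then have "card (lv k) = card (?T \<union> lv (Suc k))"
    using T l inj by (metis Un_subset_iff card_image inj_on_subset)
  also have "\<dots> = card ?T + card (lv (Suc k))"
    using T l disj finite_Y by (meson card_Un_disjoint finite_subset)
  finally show ?thesis by simp
qed

lemma card_reach_time_ge: "card {y \<in> Y. k \<le> f y} = card {y \<in> Y. k \<le> g y}"
proof (cases k)
  case (Suc m)
  interpret I: bound_system Y \<gamma> F by (rule inverse_system)
  \<comment> \<open>A run of \<open>k = Suc m\<close> points takes \<open>m\<close> steps from first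
    to last; both conditions say that the points of this same run avoid \<open>F\<close>.\<close>
  have "bij_betw (\<beta> ^^ m) {y \<in> Y. k \<le> f y} {y \<in> Y. k \<le> g y}"
  proof (rule bij_betw_byWitness[where f' = "\<gamma> ^^ m"])
    show "(\<beta> ^^ m) ` {y \<in> Y. k \<le> f y} \<subseteq> {y \<in> Y. k \<le> g y}"
      by (auto simp: Suc Suc_le_reach_time_iff I.Suc_le_reach_time_iff funpow_mem[OF bij]
          funpow_inv_into_funpow[OF bij])
    show "(\<gamma> ^^ m) ` {y \<in> Y. k \<le> g y} \<subseteq> {y \<in> Y. k \<le> f y}"
      by (auto simp: Suc Suc_le_reach_time_iff I.Suc_le_reach_time_iff funpow_mem[OF I.bij]
          funpow_funpow_inv_into[OF bij])
  qed (auto simp: funpow_inv_into_funpow[OF bij] funpow_funpow_inv_into[OF bij])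
  then show ?thesis by (rule bij_betw_same_card)
qed simp

text \<open>A level size is the difference of two consecutive tail counts, and these agree for
  \<open>f\<close> and \<open>g\<close>.\<close>

lemma card_level_inverse: "card (level Y g k) = card (lv k)"
  using card_level_plus_card_ge[OF finite_Y, of f k] card_level_plus_card_ge[OF finite_Y, of g k]
    card_reach_time_ge[of k] card_reach_time_ge[of "Suc k"] by linarith

section \<open>Stability and excursions under time reversal\<close>

text \<open>Here \<open>y\<close> is the last point of a stay in \<open>F\<close>. If the backward
  orbit first left \<open>F\<close> at step \<open>Suc k \<le> s\<close>, the point
  \<open>?z\<close> just before would be an entry into \<open>F\<close>, and stability would keep
  its next \<open>s\<close> forward iterates in \<open>F\<close>; but iterate \<open>Suc k\<close>
  of \<open>?z\<close> is \<beta> y, which is outside.\<close>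

lemma stable_inverse:
  assumes "s_stable Y \<beta> s F"
  shows "s_stable Y \<gamma> s F"
  unfolding s_stable_def
proof (intro ballI allI impI)
  fix y k assume y: "y \<in> F \<inter> \<gamma> ` (Y - F)" and "k \<le> s"
  have yY: "y \<in> Y" and \<beta>y: "\<beta> y \<notin> F"
    using y F_sub bij by (auto simp: bij_betw_inv_into_right)
  from \<open>k \<le> s\<close> show "(\<gamma> ^^ k) y \<in> F"
  proof (induction k)
    case (Suc k)
    let ?z = "(\<gamma> ^^ k) y"
    have zY: "?z \<in> Y" "\<gamma> ?z \<in> Y"
      using funpow_mem[OF bij_betw_inv_into[OF bij] yY, of k]
        funpow_mem[OF bij_betw_inv_into[OF bij] yY, of "Suc k"] by auto
    have z: "\<beta> (\<gamma> ?z) = ?z" using zY bij by (simp add: bij_betw_inv_into_right)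
    show ?case
    proof (rule ccontr)
      assume "(\<gamma> ^^ Suc k) y \<notin> F"
      then have "?z \<in> F \<inter> \<beta> ` (Y - F)"
        using Suc zY z by (auto intro!: image_eqI[of _ _ "\<gamma> ?z"])
      then have "(\<beta> ^^ Suc k) ?z \<in> F"
        using assms Suc.prems unfolding s_stable_def by blast
      then show False
        using \<beta>y funpow_funpow_inv_into[OF bij yY, of k k] by simp
    qed
  qed (use y in simp)
qed

lemma path_reach_time:
  assumes "\<And>u. u \<le> k \<Longrightarrow> \<beta> (p (Suc u)) = p u" and "p 0 \<in> F"
    and "\<And>u. u \<in> {1..k} \<Longrightarrow> p u \<in> Y - F" and "u \<le> k"
  shows "f (p u) = u"
  using \<open>u \<le> k\<close>
proof (induction u)
  case 0
  then show ?case using assms(2) F_sub reach_time_0_iff by blast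
next
  case (Suc u)
  then show ?case using reach_time_step[of "p (Suc u)"] assms(1)[of u] assms(3)[of "Suc u"] by simp
qed

lemma path_reach_time_inverse:
  assumes step: "\<And>u. u \<le> k \<Longrightarrow> \<beta> (p (Suc u)) = p u" and "p (Suc k) \<in> F"
    and mid: "\<And>u. u \<in> {1..k} \<Longrightarrow> p u \<in> Y - F" and u: "u \<in> {1..k}"
  shows "g (p u) = k - u + 1"
proof -
  interpret I: bound_system Y \<gamma> F by (rule inverse_system)
  \<comment> \<open>Reindexed from its other end, the path is a \<gamma>-path ending at
    \<open>p (Suc k)\<close>; the point \<open>p u\<close> has index \<open>Suc k - u\<close> on
    it.\<close>
  let ?q = "\<lambda>v. p (Suc k - v)"
  have "g (?q (Suc k - u)) = Suc k - u"
  proof (rule I.path_reach_time[where k = k])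
    show "?q 0 \<in> F" using assms(2) by simp
  next
    fix v assume "v \<in> {1..k}"
    then show "?q v \<in> Y - F" by (intro mid) auto
  next
    show "Suc k - u \<le> k" using u by auto
  next
    fix v assume "v \<le> k"
    then have "\<beta> (p (Suc (k - v))) = p (k - v)" and q: "?q v = p (Suc (k - v))"
      using step[of "k - v"] by (auto simp: Suc_diff_le)
    \<comment> \<open>For \<open>v = 0\<close> this is the endpoint in \<open>F\<close>, otherwise
      an interior point.\<close>
    moreover have "p (Suc (k - v)) \<in> Y"
      using assms(2) F_sub mid[of "Suc (k - v)"] \<open>v \<le> k\<close>
      by (cases v) auto
    ultimately show "\<gamma> (?q (Suc v)) = ?q v"
      using bij by (metis bij_betw_inv_into_left diff_Suc_Suc)
  qed
  then show ?thesis using u by (simp add: Suc_diff_le)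
qed

section \<open>Consequences of \<open>F\<close> entering every level\<close>

lemma mem_image_entries_iff: "k \<in> f ` \<beta> ` F \<longleftrightarrow> card (lv (Suc k)) < card (lv k)"
proof -
  have "finite (transitions \<beta> F (lv k))"
    using finite_Y F_sub by (auto simp: transitions_def intro: finite_subset)
  then have "card (lv (Suc k)) < card (lv k) \<longleftrightarrow> transitions \<beta> F (lv k) \<noteq> {}"
    using card_transitions[of k] card_gt_0_iff[of "transitions \<beta> F (lv k)"] by linarith
  also have "\<dots> \<longleftrightarrow> k \<in> f ` \<beta> ` F"
    using F_sub \<beta>_mem by (auto simp: transitions_def level_def)
  finally show ?thesis by simp
qed

lemma card_level_antimono: "j \<le> k \<Longrightarrow> card (lv k) \<le> card (lv j)"
proof (induction k rule: dec_induct)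
  case (step k)
  then show ?case using card_transitions[of k] by linarith
qed simp

text \<open>The drop from \<open>j\<close> to \<open>Suc j\<close> is strict because some point of
  \<open>F\<close> enters level \<open>j\<close>; further drops are weak. Here \<open>k\<close> may
  exceed \<open>L\<close>, where levels are empty.\<close>

lemma card_level_less:
  assumes full: "f ` \<beta> ` F = {0..L}" and "j \<le> L" "j < k"
  shows "card (lv k) < card (lv j)"
proof -
  have "card (lv k) \<le> card (lv (Suc j))" using assms by (intro card_level_antimono) auto
  also have "\<dots> < card (lv j)" using assms mem_image_entries_iff[of j] by simp
  finally show ?thesis .
qed

text \<open>By the strict drops, level 0, which is \<open>F\<close>, is the only level of maximal
  size.\<close>

lemma eq_states_full:
  assumes full: "f ` \<beta> ` F = {0..L}"
  shows "eq_states Y f = F"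
proof -
  have "Max ((\<lambda>m. card (lv m)) ` {0..L}) = card (lv 0)"
    by (rule Max_eqI) (auto intro: card_level_antimono)
  moreover have "card (lv (f y)) = card (lv 0) \<longleftrightarrow> y \<in> F" if "y \<in> Y" for y
    using card_level_less[OF full, of 0 "f y"] reach_time_0_iff[OF that] by fastforce
  ultimately show ?thesis using F_sub by (auto simp: eq_states_def)
qed

text \<open>Outside \<open>F\<close> a step lowers the reaching time by one and so moves to a
  strictly larger level.\<close>

lemma entropy_increases_full:
  assumes full: "f ` \<beta> ` F = {0..L}" and y: "y \<in> Y - F"
  shows "entropy Y f y < entropy Y f (\<beta> y)"
  using y reach_time_step[of y] reach_time_le_L[of "\<beta> y"] \<beta>_mem[of y]
  by (simp add: entropy_less_iff finite_Y card_level_less[OF full])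

lemma entropy_le_on_target:
  assumes "y \<in> F"
  shows "\<not> entropy Y f y < entropy Y f (\<beta> y)"
  using assms F_sub \<beta>_mem[of y] reach_time_0_iff[of y] card_level_antimono[of 0 "f (\<beta> y)"]
  by (auto simp: entropy_less_iff finite_Y)

lemma entropy_decreases_full:
  assumes full: "f ` \<beta> ` F = {0..L}" and y: "y \<in> F"
  shows "entropy Y f (\<beta> y) < entropy Y f y \<longleftrightarrow> \<beta> y \<notin> F"
proof -
  have m: "y \<in> Y" "\<beta> y \<in> Y" "f y = 0" using y F_sub \<beta>_mem reach_time_0_iff by auto
  show ?thesis
    using m reach_time_0_iff[of "\<beta> y"] card_level_less[OF full, of 0 "f (\<beta> y)"]
    by (auto simp: entropy_less_iff finite_Y)
qed

lemma entropy_dec_full: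
  assumes full: "f ` \<beta> ` F = {0..L}"
  shows "entropy_dec Y f \<beta> = {y \<in> F. \<beta> y \<in> Y - F}"
  using entropy_increases_full[OF full] entropy_decreases_full[OF full] F_sub \<beta>_mem
  by (fastforce simp: entropy_dec_def)

text \<open>The decreasing points are those of \<open>F\<close> that leave \<open>F\<close>;
  removing the transitions from \<open>F\<close> to itself leaves \<open>card (lv 1)\<close> by
  \<open>card_transitions\<close> at 0.\<close>

lemma card_entropy_dec_full:
  assumes full: "f ` \<beta> ` F = {0..L}"
  shows "card (entropy_dec Y f \<beta>) = card (lv 1)"
proof -
  have "entropy_dec Y f \<beta> = F - transitions \<beta> F (lv 0)"
    using F_sub \<beta>_mem by (auto simp: entropy_dec_full[OF full] transitions_def level_0)
  moreover have "transitions \<beta> F (lv 0) \<subseteq> F" by (auto simp: transitions_def)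
  moreover have "finite F" using F_sub finite_Y by (rule finite_subset)
  ultimately have "card (entropy_dec Y f \<beta>) = card F - card (transitions \<beta> F (lv 0))"
    by (metis card_Diff_subset finite_subset)
  then show ?thesis using card_transitions[of 0] by (simp add: level_0)
qed

lemma card_entropy_inc_full:
  assumes full: "f ` \<beta> ` F = {0..L}"
  shows "card (entropy_inc Y f \<beta>) = card Y - card (lv 0)"
proof -
  have "entropy_inc Y f \<beta> = Y - F"
    using entropy_increases_full[OF full] entropy_le_on_target by (auto simp: entropy_inc_def)
  then show ?thesis
    using F_sub finite_Y by (metis card_Diff_subset finite_subset level_0)
qed

lemma card_entropy_const_full:
  assumes full: "f ` \<beta> ` F = {0..L}"
  shows "card (entropy_const Y f \<beta>) = card (lv 0) - card (lv 1)"
proof -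
  have "entropy_const Y f \<beta> = transitions \<beta> F (lv 0)"
  proof -
    have "entropy Y f (\<beta> y) = entropy Y f y \<longleftrightarrow> y \<in> F \<and> \<beta> y \<in> F" if "y \<in> Y" for y
      using that entropy_increases_full[OF full, of y] entropy_decreases_full[OF full, of y]
        entropy_le_on_target[of y] by force
    then show ?thesis using F_sub by (auto simp: entropy_const_def transitions_def level_0)
  qed
  then show ?thesis using card_transitions[of 0] by simp
qed

text \<open>Entropy rises at each step before \<open>F\<close> is reached and cannot rise in a step
  from \<open>F\<close>, so the increasing run stops exactly at the reaching time.\<close>

lemma incr_length_full:
  assumes full: "f ` \<beta> ` F = {0..L}" and y: "y \<in> Y"
  shows "incr_length Y f \<beta> y = f y"
  unfolding incr_length_def
proof (rule Greatest_equality)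
  have Yj: "(\<beta> ^^ j) y \<in> Y" for j by (rule funpow_mem[OF bij y])
  have "(\<beta> ^^ j) y \<in> Y - F" if "j < f y" for j
    using that Suc_le_reach_time_iff[OF y, of j] Yj by simp
  then show "\<forall>j<f y. entropy Y f ((\<beta> ^^ j) y) < entropy Y f ((\<beta> ^^ Suc j) y)"
    using entropy_increases_full[OF full] by simp
next
  fix N assume N: "\<forall>j<N. entropy Y f ((\<beta> ^^ j) y) < entropy Y f ((\<beta> ^^ Suc j) y)"
  then have "(\<beta> ^^ j) y \<notin> F" if "j < N" for j
    using that entropy_le_on_target by auto
  then show "N \<le> f y"
    using Suc_le_reach_time_iff[OF y, of "N - 1"] by (cases N) auto
qed

lemma mean_incr_length_full:
  assumes full: "f ` \<beta> ` F = {0..L}"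
  shows "mean_incr_length Y f \<beta> = (\<Sum>k\<in>f ` Y. real k * real (card (lv k))) / real (card Y)"
  using incr_length_full[OF full] sum_by_levels[OF finite_Y, of f] by (simp add: mean_incr_length_def)

section \<open>The doubled system\<close>

abbreviation Yh where "Yh \<equiv> hat_space Y"
abbreviation Fh where "Fh \<equiv> hat_target F"
abbreviation \<beta>h where "\<beta>h \<equiv> hat_map Y \<beta>"
abbreviation fh where "fh \<equiv> reach_time \<beta>h Fh"

lemma funpow_hat_map:
  "(\<beta>h ^^ k) (i, 1) = ((\<beta> ^^ k) i, 1)" "(\<beta>h ^^ k) (i, -1) = ((\<gamma> ^^ k) i, -1)"
  by (induction k) (auto simp: hat_map_def int_iter_def)

lemma hat_map_apply: "\<beta>h (i, 1) = (\<beta> i, 1)" "\<beta>h (i, -1) = (\<gamma> i, -1)"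
  by (simp_all add: hat_map_def int_iter_def)

lemma reach_time_hat: "fh (i, 1) = f i" "fh (i, -1) = g i"
  by (simp_all add: reach_time_def funpow_hat_map) (simp_all add: hat_target_def)

lemma bij_hat_map: "bij_betw \<beta>h Yh Yh"
\<comment> \<open>Flipping the sign exchanges \<beta> and \<gamma>, so the conjugate by
  \<open>hat_rev\<close> is the inverse map.\<close>
proof (rule bij_betw_byWitness[where f' = "\<lambda>x. hat_rev (\<beta>h (hat_rev x))"])
  have \<gamma>: "\<gamma> i \<in> Y" if "i \<in> Y" for i
    using that bij_betw_apply[OF bij_betw_inv_into[OF bij]] by blast
  show "\<beta>h ` Yh \<subseteq> Yh" "(\<lambda>x. hat_rev (\<beta>h (hat_rev x))) ` Yh \<subseteq> Yh"
    using \<gamma> \<beta>_mem by (auto simp: hat_space_def hat_rev_def hat_map_apply)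
qed (use bij in \<open>auto simp: hat_space_def hat_rev_def hat_map_apply bij_betw_inv_into_left
      bij_betw_inv_into_right\<close>)

lemma reversible_hat: "reversible Yh \<beta>h hat_rev"
proof -
  have "hat_rev (\<beta>h (hat_rev x)) = inv_into Yh \<beta>h x" if x: "x \<in> Yh" for x
  proof (rule inv_into_f_eq[symmetric])
    show "inj_on \<beta>h Yh" using bij_hat_map by (rule bij_betw_imp_inj_on)
    show "hat_rev (\<beta>h (hat_rev x)) \<in> Yh"
      using x \<beta>_mem bij_betw_apply[OF bij_betw_inv_into[OF bij]]
      by (auto simp: hat_space_def hat_rev_def hat_map_apply)
    show "\<beta>h (hat_rev (\<beta>h (hat_rev x))) = x"
      using x bij by (auto simp: hat_space_def hat_rev_def hat_map_apply bij_betw_inv_into_left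
          bij_betw_inv_into_right)
  qed
  then show ?thesis
    using bij_hat_map by (auto simp: reversible_def) (auto simp: hat_space_def hat_rev_def)
qed

lemma hat_system: "bound_system Yh \<beta>h Fh"
proof
  fix x assume "x \<in> Yh"
  then obtain i where "i \<in> Y" "x = (i, 1) \<or> x = (i, -1)" by (auto simp: hat_space_def)
  then show "\<exists>k. (\<beta>h ^^ k) x \<in> Fh"
    using reaches[of i] bound_system.reaches[OF inverse_system, of i]
    by (auto simp: funpow_hat_map hat_target_def)
qed (use finite_Y F_sub bij_hat_map in \<open>auto simp: hat_space_def hat_target_def\<close>)

lemma hat_rev_target: "hat_rev ` Fh = Fh"
  by (force simp: hat_rev_def hat_target_def)

text \<open>The copy with sign 1 is the original system; the copy with sign -1 is its inverse,
  covered by \<open>stable_inverse\<close>.\<close>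

lemma stable_hat_iff: "s_stable Yh \<beta>h s Fh \<longleftrightarrow> s_stable Y \<beta> s F"
proof
  assume h: "s_stable Yh \<beta>h s Fh"
  show "s_stable Y \<beta> s F"
    unfolding s_stable_def
  proof (intro ballI allI impI)
    fix y k assume y: "y \<in> F \<inter> \<beta> ` (Y - F)" and k: "k \<le> s"
    then obtain x where x: "x \<in> Y - F" "y = \<beta> x" by blast
    then have "(y, 1) = \<beta>h (x, 1)" "(x, 1) \<in> Yh - Fh" "(y, 1) \<in> Fh"
      using y by (auto simp: hat_map_apply hat_space_def hat_target_def)
    then have "(\<beta>h ^^ k) (y, 1) \<in> Fh" using h k unfolding s_stable_def by blast
    then show "(\<beta> ^^ k) y \<in> F" by (simp add: funpow_hat_map hat_target_def)
  qed
next
  assume s: "s_stable Y \<beta> s F"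
  show "s_stable Yh \<beta>h s Fh"
    unfolding s_stable_def
  proof (intro ballI allI impI)
    fix x k assume x: "x \<in> Fh \<inter> \<beta>h ` (Yh - Fh)" and k: "k \<le> s"
    then obtain j t where j: "(j, t) \<in> Yh - Fh" "x = \<beta>h (j, t)" by auto
    then consider "t = 1" "j \<in> Y - F" | "t = -1" "j \<in> Y - F"
      by (auto simp: hat_space_def hat_target_def)
    then show "(\<beta>h ^^ k) x \<in> Fh"
    proof cases
      case 1
      then have "x = (\<beta> j, 1)" "\<beta> j \<in> F \<inter> \<beta> ` (Y - F)"
        using j x by (auto simp: hat_map_apply hat_target_def)
      then show ?thesis
        using s k unfolding s_stable_def by (simp add: funpow_hat_map hat_target_def)
    next
      case 2
      then have "x = (\<gamma> j, -1)" "\<gamma> j \<in> F \<inter> \<gamma> ` (Y - F)"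
        using j x by (auto simp: hat_map_apply hat_target_def)
      then show ?thesis
        using stable_inverse[OF s] k unfolding s_stable_def
        by (simp add: funpow_hat_map hat_target_def)
    qed
  qed
qed

lemma level_hat: "level Yh fh k = lv k \<times> {1} \<union> level Y g k \<times> {-1}"
  by (auto simp: level_def hat_space_def reach_time_hat)

lemma card_level_hat: "card (level Yh fh k) = 2 * card (lv k)"
proof -
  have "finite (level Y g k)" using finite_Y by (simp add: level_def)
  then have "card (lv k \<times> {1 :: int} \<union> level Y g k \<times> {-1}) = card (lv k) + card (level Y g k)"
    using finite_level by (subst card_Un_disjoint) (auto simp: card_cartesian_product)
  then show ?thesis by (simp add: level_hat card_level_inverse)
qed

text \<open>The values taken are the indices of nonempty levels, and the level sizes agree.\<close>

lemma image_reach_time_inverse: "g ` Y = f ` Y"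
proof -
  have "finite (level Y g k)" for k using finite_Y by (simp add: level_def)
  then have "level Y g k \<noteq> {} \<longleftrightarrow> lv k \<noteq> {}" for k
    by (metis card_0_eq card_level_inverse finite_level)
  then show ?thesis by (simp add: image_eq_nonempty_levels)
qed

lemma image_reach_time_hat: "fh ` Yh = f ` Y"
proof -
  have "fh ` Yh = f ` Y \<union> g ` Y"
    by (force simp: hat_space_def reach_time_hat)
  then show ?thesis by (simp add: image_reach_time_inverse)
qed

lemma card_hat_space: "card Yh = 2 * card Y"
  by (simp add: hat_space_def card_cartesian_product)

text \<open>Membership of \<open>k\<close> compares consecutive level sizes, and doubling all sizes
  preserves the comparison.\<close>

lemma image_entries_hat: "fh ` \<beta>h ` Fh = f ` \<beta> ` F"
proof -
  interpret H: bound_system Yh \<beta>h Fh by (rule hat_system)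
  show ?thesis
    by (rule set_eqI) (simp only: H.mem_image_entries_iff mem_image_entries_iff card_level_hat,
        simp)
qed

lemma excursion_reach_times:
  assumes ex: "excursion Yh \<beta>h Fh i s k" and u: "u \<in> {1..k}"
  shows "(i u, s) \<in> Yh" "hat_rev (i u, s) \<in> Yh"
    and "fh (i u, s) = u" "fh (hat_rev (i u, s)) = k - u + 1"
proof -
  interpret H: bound_system Yh \<beta>h Fh by (rule hat_system)
  let ?p = "\<lambda>u. (i u, s)"
  have p: "\<And>u. u \<le> k \<Longrightarrow> \<beta>h (?p (Suc u)) = ?p u" "?p 0 \<in> Fh" "?p (Suc k) \<in> Fh"
    "\<And>u. u \<in> {1..k} \<Longrightarrow> ?p u \<in> Yh - Fh"
    using ex unfolding excursion_def by auto
  show m: "(i u, s) \<in> Yh" using p(4)[OF u] by simp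
  then show "hat_rev (i u, s) \<in> Yh" by (auto simp: hat_rev_def hat_space_def)
  show "fh (i u, s) = u" using H.path_reach_time[of k ?p u] p u by simp
  \<comment> \<open>Reversal turns this into the backward reaching time, that is, the distance to
    the start of the excursion.\<close>
  show "fh (hat_rev (i u, s)) = k - u + 1"
    using H.path_reach_time_inverse[of k ?p u] p u
      reach_time_reversed[OF reversible_hat H.F_sub hat_rev_target m] by simp
qed

lemma entropy_hat_rev_iff:
  assumes ex: "excursion Yh \<beta>h Fh i s k" and u: "u \<in> {1..k}"
  shows "entropy Yh fh (hat_rev (i u, s)) = entropy Yh fh (i u, s)
    \<longleftrightarrow> card (lv u) = card (lv (k - u + 1))"
  using excursion_reach_times[OF assms] bound_system.finite_Y[OF hat_system]
  by (auto simp: entropy_eq_iff card_level_hat)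

lemma entropy_hat_rev_full_iff:
  assumes full: "f ` \<beta> ` F = {0..L}"
    and ex: "excursion Yh \<beta>h Fh i s k" and u: "u \<in> {1..k}"
  shows "entropy Yh fh (hat_rev (i u, s)) = entropy Yh fh (i u, s) \<longleftrightarrow> real u = (real k + 1) / 2"
proof -
  note r = excursion_reach_times[OF ex u]
  \<comment> \<open>Both indices occur as reaching times, hence are at most \<open>L\<close>, the
    range where level sizes decrease strictly and so determine the index.\<close>
  have "u \<in> fh ` Yh" "k - u + 1 \<in> fh ` Yh" using r by (metis imageI)+
  then have "u \<le> L" "k - u + 1 \<le> L"
    using finite_Y by (auto simp: image_reach_time_hat)
  then have "card (lv u) = card (lv (k - u + 1)) \<longleftrightarrow> u = k - u + 1"
    using card_level_less[OF full, of u "k - u + 1"] card_level_less[OF full, of "k - u + 1" u]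
    by (metis less_irrefl linorder_neqE_nat)
  also have "\<dots> \<longleftrightarrow> real u = (real k + 1) / 2" using u by (auto simp: field_simps)
  finally show ?thesis by (simp add: entropy_hat_rev_iff[OF ex u])
qed

end

section \<open>Comparison of the system with its double\<close>

theorem theorem31:
  fixes X E :: "'a set" and \<alpha> :: "'a \<Rightarrow> 'a"
  assumes "finite X" and "bij_betw \<alpha> X X" and "E \<subseteq> X" and "bound_by X \<alpha> E"
  defines "e \<equiv> reach_time \<alpha> E"
    and "e' \<equiv> reach_time (inv_into X \<alpha>) E"
  defines "L \<equiv> Max (e ` X)"
  defines "Xh \<equiv> hat_space X"
    and "Eh \<equiv> hat_target E"
    and "\<alpha>h \<equiv> hat_map X \<alpha>"
  defines "eh \<equiv> reach_time \<alpha>h Eh"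
  defines "Lh \<equiv> Max (eh ` Xh)"
  defines "Sh \<equiv> entropy Xh eh"
  shows
    "reversible Xh \<alpha>h hat_rev \<and> bound_by Xh \<alpha>h Eh \<and>
     \<comment> \<open>(a)\<close>
     (hat_rev ` Eh = Eh \<and>
      (\<forall>s. s_stable Xh \<alpha>h s Eh \<longleftrightarrow> s_stable X \<alpha> s E) \<and>
      Lh = Max (e ` X) \<and> Max (e ` X) = Max (e' ` X) \<and> Max (e' ` X) = L \<and>
      (\<forall>k. level Xh eh k = level X e k \<times> {1} \<union> level X e' k \<times> {-1} \<and>
           (level X e k \<times> {1 :: int}) \<inter> (level X e' k \<times> {-1}) = {} \<and>
           card (level Xh eh k) = 2 * card (level X e k))) \<and>
     \<comment> \<open>(b)\<close>
     (\<forall>i s k. excursion Xh \<alpha>h Eh i s k \<longrightarrow>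
        (\<forall>u \<in> {1..k}. Sh (hat_rev (i u, s)) = Sh (i u, s) \<longleftrightarrow>
                       card (level X e u) = card (level X e (k - u + 1)))) \<and>
     \<comment> \<open>(c)\<close>
     (e ` \<alpha> ` E = {0..L} \<longleftrightarrow> eh ` \<alpha>h ` Eh = {0..L}) \<and>
     \<comment> \<open>(d)\<close>
     (e ` \<alpha> ` E = {0..L} \<longrightarrow>
        eq_states Xh eh = Eh \<and>
        neq_states Xh eh = Xh - Eh \<and>
        entropy_dec Xh eh \<alpha>h = {x \<in> eq_states Xh eh. \<alpha>h x \<in> neq_states Xh eh} \<and>
        (\<forall>x \<in> neq_states Xh eh. Sh x < Sh (\<alpha>h x)) \<and>
        (\<forall>k \<in> {0..L}. int (card (transitions \<alpha>h (eq_states Xh eh) (level Xh eh k))) =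
                       2 * (int (card (level X e k)) - int (card (level X e (k + 1))))) \<and>
        (\<forall>i s k. excursion Xh \<alpha>h Eh i s k \<longrightarrow>
           (\<forall>u \<in> {1..k}. Sh (hat_rev (i u, s)) = Sh (i u, s) \<longleftrightarrow>
                          real u = (real k + 1) / 2)) \<and>
        real (card (entropy_dec Xh eh \<alpha>h)) / real (card Xh) =
          real (card (entropy_dec X e \<alpha>)) / real (card X) \<and>
        real (card (entropy_inc Xh eh \<alpha>h)) / real (card Xh) =
          real (card (entropy_inc X e \<alpha>)) / real (card X) \<and>
        real (card (entropy_const Xh eh \<alpha>h)) / real (card Xh) =
          real (card (entropy_const X e \<alpha>)) / real (card X) \<and>
        mean_incr_length Xh eh \<alpha>h = mean_incr_length X e \<alpha>)"
proof -
  interpret B: bound_system X \<alpha> E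
    using assms(1-4) bound_by_iff_reaches[OF assms(1,2)] by unfold_locales auto
  interpret H: bound_system Xh \<alpha>h Eh
    unfolding Xh_def Eh_def \<alpha>h_def by (rule B.hat_system)
  note defs = Xh_def Eh_def \<alpha>h_def eh_def e_def e'_def L_def Lh_def Sh_def
  have bound: "bound_by Xh \<alpha>h Eh"
    using bound_by_iff_reaches[OF H.finite_Y H.bij] H.reaches by blast
  have Lh: "Lh = L" and L': "Max (e' ` X) = L"
    by (simp_all add: defs B.image_reach_time_hat B.image_reach_time_inverse)
  have a: "level Xh eh k = level X e k \<times> {1} \<union> level X e' k \<times> {-1} \<and>
      (level X e k \<times> {1 :: int}) \<inter> (level X e' k \<times> {-1}) = {}" for k
    by (auto simp: defs B.level_hat)
  have card_lv: "card (level Xh eh k) = 2 * card (level X e k)" for k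
    unfolding defs by (rule B.card_level_hat)
  have b: "Sh (hat_rev (i u, s)) = Sh (i u, s) \<longleftrightarrow>
      card (level X e u) = card (level X e (k - u + 1))"
    if "excursion Xh \<alpha>h Eh i s k" "u \<in> {1..k}" for i s k u
    using that unfolding defs by (rule B.entropy_hat_rev_iff)
  have c: "eh ` \<alpha>h ` Eh = e ` \<alpha> ` E"
    unfolding defs by (rule B.image_entries_hat)
  have d: "eq_states Xh eh = Eh \<and>
        neq_states Xh eh = Xh - Eh \<and>
        entropy_dec Xh eh \<alpha>h = {x \<in> eq_states Xh eh. \<alpha>h x \<in> neq_states Xh eh} \<and>
        (\<forall>x \<in> neq_states Xh eh. Sh x < Sh (\<alpha>h x)) \<and>
        (\<forall>k \<in> {0..L}. int (card (transitions \<alpha>h (eq_states Xh eh) (level Xh eh k))) =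
                       2 * (int (card (level X e k)) - int (card (level X e (k + 1))))) \<and>
        (\<forall>i s k. excursion Xh \<alpha>h Eh i s k \<longrightarrow>
           (\<forall>u \<in> {1..k}. Sh (hat_rev (i u, s)) = Sh (i u, s) \<longleftrightarrow>
                          real u = (real k + 1) / 2)) \<and>
        real (card (entropy_dec Xh eh \<alpha>h)) / real (card Xh) =
          real (card (entropy_dec X e \<alpha>)) / real (card X) \<and>
        real (card (entropy_inc Xh eh \<alpha>h)) / real (card Xh) =
          real (card (entropy_inc X e \<alpha>)) / real (card X) \<and>
        real (card (entropy_const Xh eh \<alpha>h)) / real (card Xh) =
          real (card (entropy_const X e \<alpha>)) / real (card X) \<and>
        mean_incr_length Xh eh \<alpha>h = mean_incr_length X e \<alpha>"
    if full: "e ` \<alpha> ` E = {0..L}"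
  proof -
    have fB: "reach_time \<alpha> E ` \<alpha> ` E = {0..Max (reach_time \<alpha> E ` X)}"
      using full by (simp add: e_def L_def)
    \<comment> \<open>Fullness passes to the double, so each full-entry result applies to both
      instances \<open>B\<close> and \<open>H\<close>.\<close>
    have fH: "reach_time \<alpha>h Eh ` \<alpha>h ` Eh = {0..Max (reach_time \<alpha>h Eh ` Xh)}"
      using full c Lh by (simp add: eh_def Lh_def)
    have eq: "eq_states Xh eh = Eh" unfolding eh_def by (rule H.eq_states_full[OF fH])
    then have neq: "neq_states Xh eh = Xh - Eh" by (simp add: neq_states_def)
    have dec: "entropy_dec Xh eh \<alpha>h = {x \<in> eq_states Xh eh. \<alpha>h x \<in> neq_states Xh eh}"
      unfolding eq neq unfolding eh_def by (rule H.entropy_dec_full[OF fH])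
    have inc: "\<forall>x \<in> neq_states Xh eh. Sh x < Sh (\<alpha>h x)"
      unfolding neq unfolding Sh_def eh_def using H.entropy_increases_full[OF fH] by blast
    have trans: "int (card (transitions \<alpha>h (eq_states Xh eh) (level Xh eh k))) =
        2 * (int (card (level X e k)) - int (card (level X e (k + 1))))" for k
      using H.card_transitions[of k] card_lv[of k] card_lv[of "Suc k"]
      unfolding eq eh_def[symmetric] by simp
    have rev: "Sh (hat_rev (i u, s)) = Sh (i u, s) \<longleftrightarrow> real u = (real k + 1) / 2"
      if "excursion Xh \<alpha>h Eh i s k" "u \<in> {1..k}" for i s k u
      using B.entropy_hat_rev_full_iff[OF fB] that unfolding defs by blast
    have cX: "card Xh = 2 * card X" unfolding Xh_def by (rule B.card_hat_space)
    have "card (entropy_dec Xh eh \<alpha>h) = 2 * card (entropy_dec X e \<alpha>)"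
      using H.card_entropy_dec_full[OF fH] B.card_entropy_dec_full[OF fB] card_lv[of 1]
      by (simp add: eh_def e_def)
    moreover have "card (entropy_inc Xh eh \<alpha>h) = 2 * card (entropy_inc X e \<alpha>)"
      using H.card_entropy_inc_full[OF fH] B.card_entropy_inc_full[OF fB] card_lv[of 0] cX
      by (simp add: eh_def e_def)
    moreover have "card (entropy_const Xh eh \<alpha>h) = 2 * card (entropy_const X e \<alpha>)"
      using H.card_entropy_const_full[OF fH] B.card_entropy_const_full[OF fB] card_lv[of 0]
        card_lv[of 1] by (simp add: eh_def e_def)
    moreover have "mean_incr_length Xh eh \<alpha>h = mean_incr_length X e \<alpha>"
    proof -
      \<comment> \<open>Both means become sums over the same index set; level sizes and the size of
        the space double, and the factor cancels.\<close>
      have im: "eh ` Xh = e ` X" unfolding defs by (rule B.image_reach_time_hat)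
      have "mean_incr_length Xh eh \<alpha>h =
          (\<Sum>k\<in>e ` X. real k * real (card (level Xh eh k))) / real (card Xh)"
        using H.mean_incr_length_full[OF fH] unfolding eh_def[symmetric] im .
      also have "\<dots> = 2 * (\<Sum>k\<in>e ` X. real k * real (card (level X e k))) / (2 * real (card X))"
        by (simp add: card_lv cX sum_distrib_left mult_ac)
      also have "\<dots> = mean_incr_length X e \<alpha>"
        using B.mean_incr_length_full[OF fB] unfolding e_def[symmetric] by simp
      finally show ?thesis .
    qed
    ultimately show ?thesis using eq neq dec inc trans rev cX by simp
  qed
  show ?thesis
  proof (intro conjI)
    show "reversible Xh \<alpha>h hat_rev" unfolding defs by (rule B.reversible_hat)
    show "hat_rev ` Eh = Eh" unfolding defs by (rule B.hat_rev_target)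
    show "\<forall>s. s_stable Xh \<alpha>h s Eh \<longleftrightarrow> s_stable X \<alpha> s E"
      unfolding defs using B.stable_hat_iff by blast
    show "Lh = Max (e ` X)" "Max (e ` X) = Max (e' ` X)" "Max (e' ` X) = L"
      using Lh L' by (simp_all add: L_def)
    show "e ` \<alpha> ` E = {0..L} \<longleftrightarrow> eh ` \<alpha>h ` Eh = {0..L}" by (simp only: c)
    show "\<forall>k. level Xh eh k = level X e k \<times> {1} \<union> level X e' k \<times> {-1} \<and>
        (level X e k \<times> {1 :: int}) \<inter> (level X e' k \<times> {-1}) = {} \<and>
        card (level Xh eh k) = 2 * card (level X e k)"
      using a card_lv by simp
    show "\<forall>i s k. excursion Xh \<alpha>h Eh i s k \<longrightarrow>
        (\<forall>u \<in> {1..k}. Sh (hat_rev (i u, s)) = Sh (i u, s) \<longleftrightarrow>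
          card (level X e u) = card (level X e (k - u + 1)))"
      using b by blast
  \<comment> \<open>The two goals left are boundness of the double and (d).\<close>
  qed (fact bound, rule impI, erule d)
qed

end
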